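(* Let $b\in(0,\frac12)$ and $a=\frac14$. Then the attractor $\bigcap_{t\ge0}\phi_t(\tilde\Pi)$ of the billiard flow $\phi_t$ on the square table with one-sided mirror $I=\{\frac14\}\times[0,b]$ has positive, but not full, measure in the phase space $\tilde\Pi$.
   Context: The table is the square $\Pi=[0,\frac12]\times[0,\frac12]$ with a vertical wall $I=\{a\}\times[0,b]$, $a=\frac14$. A point particle moves at unit speed along straight lines; at the boundary of the square it is reflected by the usual law (angle of incidence equals angle of reflection). If it arrives at $I$ from the left it passes through unperturbed; if it arrives at $I$ from the right it is reflected by the usual law. The billiard flow $\phi_t$, $t\ge0$ (a semiflow, since it is not invertible), is defined on the phase space $\tilde\Pi=\Pi\times\mathbb S^1$ (position and direction), with the identifications on the boundary given by the reflection rules. Measure means Lebesgue measure on $\Pi\times\mathbb S^1$. *)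

theory Defs
  imports "HOL-Analysis.Analysis"
begin

text \<open>A state is a pair (position, direction), the direction being a unit vector of the plane.\<close>

type_synonym state = "(real \<times> real) \<times> (real \<times> real)"

definition table :: "(real \<times> real) set" where
  "table = {0..1/2} \<times> {0..1/2}"

definition phase_space :: "state set" where
  "phase_space = table \<times> sphere 0 1"

definition mirror :: "real \<Rightarrow> real \<Rightarrow> (real \<times> real) set" where
  "mirror a b = {a} \<times> {0..b}"

text \<open>
  A particle at \<open>p\<close> with velocity \<open>v\<close> is reflected by a vertical wall if it runs into the left or
  the right side of the square, or if it is on the mirror (end points included) and moves to the
  left, i.e. arrives from the right. Motion along a side or along the mirror is not affected
  by it.
\<close>

definition hits_vertical :: "real \<Rightarrow> real \<Rightarrow> real \<times> real \<Rightarrow> real \<times> real \<Rightarrow> bool" where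
  "hits_vertical a b p v \<longleftrightarrow>
     fst p = 0 \<and> fst v < 0 \<or> fst p = 1/2 \<and> fst v > 0 \<or> p \<in> mirror a b \<and> fst v < 0"

definition hits_horizontal :: "real \<times> real \<Rightarrow> real \<times> real \<Rightarrow> bool" where
  "hits_horizontal p v \<longleftrightarrow> snd p = 0 \<and> snd v < 0 \<or> snd p = 1/2 \<and> snd v > 0"

text \<open>At a corner, or at the foot of the mirror, both components may be reversed at once.\<close>

definition reflect :: "real \<Rightarrow> real \<Rightarrow> state \<Rightarrow> state" where
  "reflect a b = (\<lambda>(p, v).
     (p, (if hits_vertical a b p v then - fst v else fst v,
          if hits_horizontal p v then - snd v else snd v)))"

text \<open>For a state not about to be reflected, the time until the next reflection.\<close>

definition flight_time :: "real \<Rightarrow> real \<Rightarrow> state \<Rightarrow> real" where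
  "flight_time a b = (\<lambda>(p, v).
     Inf {t. 0 < t \<and> (hits_vertical a b (p + t *\<^sub>R v) v \<or> hits_horizontal (p + t *\<^sub>R v) v)})"

definition free_flight :: "real \<Rightarrow> state \<Rightarrow> state" where
  "free_flight t = (\<lambda>(p, v). (p + t *\<^sub>R v, v))"

definition collision_map :: "real \<Rightarrow> real \<Rightarrow> state \<Rightarrow> state" where
  "collision_map a b z = reflect a b (free_flight (flight_time a b z) z)"

definition collision_time :: "real \<Rightarrow> real \<Rightarrow> state \<Rightarrow> nat \<Rightarrow> real" where
  "collision_time a b z n = (\<Sum>k<n. flight_time a b ((collision_map a b ^^ k) z))"

text \<open>
  The identification of incoming with reflected states is rendered by always representing a class
  by its reflected state: \<open>reflect\<close> is applied to the initial state and, through \<open>collision_map\<close>,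
  at each collision. In particular \<open>flow a b 0\<close> is \<open>reflect a b\<close>, which is the identity of the
  identified phase space. The number \<open>n\<close> is the number of collisions in the time interval from
  0 (excluded) to \<open>t\<close> (included).
\<close>

definition flow :: "real \<Rightarrow> real \<Rightarrow> real \<Rightarrow> state \<Rightarrow> state" where
  "flow a b t z =
     (let z0 = reflect a b z;
          n = (LEAST n. t < collision_time a b z0 (Suc n))
      in free_flight (t - collision_time a b z0 n) ((collision_map a b ^^ n) z0))"

definition attractor :: "real \<Rightarrow> real \<Rightarrow> state set" where
  "attractor a b = (\<Inter>t\<in>{0..}. flow a b t ` phase_space)"

text \<open>Arc length on the unit circle, and Lebesgue measure on the product of table and circle.\<close>

definition circle_measure :: "(real \<times> real) measure" where
  "circle_measure =
     distr (restrict_space lborel {0..<2 * pi}) (restrict_space borel (sphere 0 1))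
       (\<lambda>\<theta>. (cos \<theta>, sin \<theta>))"

definition phase_measure :: "state measure" where
  "phase_measure = completion (restrict_space lborel table \<Otimes>\<^sub>M circle_measure)"

lemma space_phase_measure: "space phase_measure = phase_space"
  by (simp add: phase_measure_def phase_space_def circle_measure_def space_pair_measure
      space_restrict_space)

lemma emeasure_circle_measure: "emeasure circle_measure (sphere 0 1) = ennreal (2 * pi)"
proof -
  have m: "(\<lambda>\<theta>. (cos \<theta>, sin \<theta>)) \<in> measurable (restrict_space lborel {0..<2 * pi})
             (restrict_space borel (sphere (0 :: real \<times> real) 1))"
    by (intro measurable_restrict_space2 measurable_restrict_space1)
       (auto simp: norm_Pair intro!: borel_measurable_continuous_onI continuous_intros)
  have "sphere (0 :: real \<times> real) 1 \<in> sets (restrict_space borel (sphere 0 1))"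
    by (simp add: sets_restrict_space_iff)
  moreover have "(\<lambda>\<theta>. (cos \<theta>, sin \<theta>)) -` sphere (0 :: real \<times> real) 1
      \<inter> space (restrict_space lborel {0..<2 * pi}) = {0..<2 * pi}"
    by (auto simp: space_restrict_space norm_Pair)
  ultimately show ?thesis
    unfolding circle_measure_def using m
    by (simp add: emeasure_distr emeasure_restrict_space)
qed

lemma emeasure_phase_space: "emeasure phase_measure phase_space = ennreal (pi / 2)"
proof -
  have t: "emeasure lborel table = ennreal (1/4)"
  proof -
    have "emeasure lborel table = emeasure lborel {0..1/2 :: real} * emeasure lborel {0..1/2 :: real}"
      unfolding table_def lborel_prod[symmetric]
      by (subst lborel.emeasure_pair_measure_Times) auto
    also have "\<dots> = ennreal (1/2) * ennreal (1/2)"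
      by (simp only: emeasure_lborel_Icc_eq) simp
    also have "\<dots> = ennreal (1/4)"
      by (subst ennreal_mult[symmetric]) simp_all
    finally show ?thesis .
  qed
  have T: "table \<in> sets borel"
    unfolding table_def by (intro borel_closed closed_Times) auto
  have c: "space circle_measure = sphere 0 1"
    by (simp add: circle_measure_def space_restrict_space)
  interpret circle: finite_measure circle_measure
    by standard (simp add: c emeasure_circle_measure)
  have S: "sphere 0 1 \<in> sets circle_measure"
    using sets.top[of circle_measure] by (simp add: c)
  have T': "table \<in> sets (restrict_space lborel table)"
    using T by (simp add: sets_restrict_space_iff)
  show ?thesis
    unfolding phase_measure_def phase_space_def using T T' S
    by (simp add: circle.emeasure_pair_measure_Times emeasure_circle_measure
        emeasure_restrict_space t flip: ennreal_mult)
qed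

end

theory Submission
  imports Defs
begin

text \<open>
  Unfolding the table turns the height of the particle into a zigzag function of a linearly growing
  lift \<open>Y\<close>. As \<open>a = 1/4\<close>, the two halves of the table are mirror images, so the distance to
  the line of the mirror is a zigzag function of a linear lift \<open>X\<close> as well, whichever half the
  particle is in, and that line is reached exactly when \<open>X\<close> is an integer. The only further datum
  is the half, a single bit: at each integer value of \<open>X\<close> it becomes ``right'' if the particle came
  from the left or meets the mirror, and ``left'' otherwise. The lifted lines being invertible, a
  state belongs to the attractor if and only if its bit can be reached from arbitrarily many
  crossings back. If the last crossing was at the height of the mirror, the bit is ``right''
  whatever happened before. So states shortly to the right of the mirror that move away from
  it are in the attractor, whereas their mirror images are not.
\<close>

section \<open>Zigzag functions\<close>

definition zigzag :: "real \<Rightarrow> real" where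
  "zigzag Y = (if frac Y < 1/2 then frac Y else 1 - frac Y)"

definition slope :: "real \<Rightarrow> real" where
  "slope Y = (if frac Y < 1/2 then 1 else - 1)"

lemma zigzag_up:
  assumes "of_int k \<le> Y" "Y < of_int k + 1/2"
  shows "zigzag Y = Y - of_int k" "slope Y = 1"
proof -
  have "\<lfloor>Y\<rfloor> = k"
    using assms by (intro floor_unique) auto
  then show "zigzag Y = Y - of_int k" "slope Y = 1"
    using assms by (auto simp: zigzag_def slope_def frac_def)
qed

lemma zigzag_down:
  assumes "of_int k + 1/2 \<le> Y" "Y < of_int k + 1"
  shows "zigzag Y = of_int k + 1 - Y" "slope Y = - 1"
proof -
  have "\<lfloor>Y\<rfloor> = k"
    using assms by (intro floor_unique) auto
  then show "zigzag Y = of_int k + 1 - Y" "slope Y = - 1"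
    using assms by (auto simp: zigzag_def slope_def frac_def)
qed

lemma zigzag_cases:
  obtains (up) k where "of_int k \<le> Y" "Y < of_int k + 1/2" "\<lfloor>Y\<rfloor> = k"
      "zigzag Y = Y - of_int k" "slope Y = 1"
  | (down) k where "of_int k + 1/2 \<le> Y" "Y < of_int k + 1" "\<lfloor>Y\<rfloor> = k"
      "zigzag Y = of_int k + 1 - Y" "slope Y = - 1"
proof (cases "Y < of_int \<lfloor>Y\<rfloor> + 1/2")
  case True
  then show ?thesis
    using up[of "\<lfloor>Y\<rfloor>"] zigzag_up[of "\<lfloor>Y\<rfloor>" Y] by simp
next
  case False
  then show ?thesis
    using down[of "\<lfloor>Y\<rfloor>"] zigzag_down[of "\<lfloor>Y\<rfloor>" Y] by (simp add: not_less)
qed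

lemma zigzag_bounds: "0 \<le> zigzag Y" "zigzag Y \<le> 1/2"
  by (cases Y rule: zigzag_cases; simp)+

lemma zigzag_0_iff: "zigzag Y = 0 \<longleftrightarrow> Y = of_int \<lfloor>Y\<rfloor>"
  by (cases Y rule: zigzag_cases) auto

lemma zigzag_0_imp_slope: "zigzag Y = 0 \<Longrightarrow> slope Y = 1"
  by (cases Y rule: zigzag_cases) auto

lemma zigzag_half_imp_slope: "zigzag Y = 1/2 \<Longrightarrow> slope Y = - 1"
  by (cases Y rule: zigzag_cases) auto

lemma zigzag_turn_imp_Ints:
  assumes "zigzag Y = 0 \<or> zigzag Y = 1/2"
  shows "2 * Y \<in> \<int>"
proof (cases Y rule: zigzag_cases)
  case (up k)
  then have "2 * Y = of_int (2 * k) \<or> 2 * Y = of_int (2 * k + 1)"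
    using assms by auto
  then show ?thesis
    by (metis Ints_of_int)
next
  case (down k)
  then have "2 * Y = of_int (2 * k + 2) \<or> 2 * Y = of_int (2 * k + 1)"
    using assms by auto
  then show ?thesis
    by (metis Ints_of_int)
qed

lemma zigzag_cong: "frac X = frac Y \<Longrightarrow> zigzag X = zigzag Y"
  by (simp add: zigzag_def)

lemma frac_add_cong:
  fixes x y :: real
  shows "frac x = frac y \<Longrightarrow> frac (x + c) = frac (y + c)"
  by (simp add: frac_add)

lemma frac_eqI_zigzag: "zigzag X = zigzag Y \<Longrightarrow> slope X = slope Y \<Longrightarrow> frac X = frac Y"
  by (auto simp: zigzag_def slope_def split: if_splits)

lemma zigzag_of_abs_le_half: "\<bar>Y\<bar> \<le> 1/2 \<Longrightarrow> zigzag Y = \<bar>Y\<bar>"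
proof -
  assume Y: "\<bar>Y\<bar> \<le> 1/2"
  consider "0 \<le> Y" "Y < 1/2" | "Y = 1/2" | "Y < 0"
    using Y by linarith
  then show ?thesis
    using Y zigzag_up[of 0 Y] zigzag_down[of 0 Y] zigzag_down[of "-1" Y]
    by cases (simp_all add: abs_if del: eq_divide_eq_numeral1)
qed

lemma zigzag_segment:
  assumes w: "0 < w" and t: "0 < t"
    and free: "\<And>r. 0 < r \<Longrightarrow> r < t \<Longrightarrow>
      \<not> hits_horizontal (x r, zigzag Y + r * (w * slope Y)) (c, w * slope Y)"
  shows "zigzag (Y + w * t) = zigzag Y + t * (w * slope Y)"
    and "w * slope (Y + w * t) =
      (if hits_horizontal (x t, zigzag Y + t * (w * slope Y)) (c, w * slope Y)
       then - (w * slope Y) else w * slope Y)"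
proof -
  have pos: "0 < t * w"
    using t w by simp
  have "zigzag (Y + w * t) = zigzag Y + t * (w * slope Y) \<and>
    w * slope (Y + w * t) =
      (if hits_horizontal (x t, zigzag Y + t * (w * slope Y)) (c, w * slope Y)
       then - (w * slope Y) else w * slope Y)"
  proof (cases Y rule: zigzag_cases)
    case (up k)
    define r where "r = (k + 1/2 - Y) / w"
    have r: "0 < r" "r * w = k + 1/2 - Y"
      using up(2) w by (simp_all add: r_def)
    have "\<not> r < t"
      using free[of r] r w up(4,5) by (auto simp: hits_horizontal_def)
    then have le: "t * w \<le> k + 1/2 - Y"
      using w r(2) by (metis mult_le_cancel_right_pos not_less)
    show ?thesis
    proof (cases "t * w = k + 1/2 - Y")
      case True
      then have "zigzag (Y + t * w) = 1/2" "slope (Y + t * w) = - 1"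
        using zigzag_down[of k "Y + t * w"] by simp_all
      then show ?thesis
        using up(4,5) True w by (simp add: hits_horizontal_def mult.commute[of w])
    next
      case False
      then have "Y + t * w < k + 1/2"
        using le by linarith
      moreover from this have "zigzag (Y + t * w) = Y + t * w - k" "slope (Y + t * w) = 1"
        using zigzag_up[of k "Y + t * w"] up(1) pos by linarith+
      ultimately show ?thesis
        using up(4,5) w by (simp add: hits_horizontal_def mult.commute[of w])
    qed
  next
    case (down k)
    define r where "r = (k + 1 - Y) / w"
    have r: "0 < r" "r * w = k + 1 - Y"
      using down(2) w by (simp_all add: r_def)
    have "\<not> r < t"
      using free[of r] r w down(4,5) by (auto simp: hits_horizontal_def)
    then have le: "t * w \<le> k + 1 - Y"
      using w r(2) by (metis mult_le_cancel_right_pos not_less)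
    show ?thesis
    proof (cases "t * w = k + 1 - Y")
      case True
      then have "zigzag (Y + t * w) = 0" "slope (Y + t * w) = 1"
        using zigzag_up[of "k + 1" "Y + t * w"] by simp_all
      then show ?thesis
        using down(4,5) True w by (simp add: hits_horizontal_def mult.commute[of w])
    next
      case False
      then have "Y + t * w < k + 1"
        using le by linarith
      moreover from this have "zigzag (Y + t * w) = k + 1 - (Y + t * w)" "slope (Y + t * w) = - 1"
        using zigzag_down[of k "Y + t * w"] down(1) pos by linarith+
      ultimately show ?thesis
        using down(4,5) w by (simp add: hits_horizontal_def mult.commute[of w])
    qed
  qed
  then show "zigzag (Y + w * t) = zigzag Y + t * (w * slope Y)"
    and "w * slope (Y + w * t) =
      (if hits_horizontal (x t, zigzag Y + t * (w * slope Y)) (c, w * slope Y)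
       then - (w * slope Y) else w * slope Y)"
    by auto
qed

section \<open>Flight times\<close>

definition collision_times :: "real \<Rightarrow> real \<Rightarrow> state \<Rightarrow> real set" where
  "collision_times a b = (\<lambda>(p, v).
     {t. 0 < t \<and> (hits_vertical a b (p + t *\<^sub>R v) v \<or> hits_horizontal (p + t *\<^sub>R v) v)})"

lemma flight_time_eq_Inf: "flight_time a b z = Inf (collision_times a b z)"
  by (simp add: flight_time_def collision_times_def split: prod.split)

lemma hits_verticalD: "hits_vertical a b p v \<Longrightarrow> fst p \<in> {0, 1/2, a} \<and> fst v \<noteq> 0"
  by (auto simp: hits_vertical_def mirror_def)

lemma hits_horizontalD: "hits_horizontal p v \<Longrightarrow> snd p \<in> {0, 1/2} \<and> snd v \<noteq> 0"
  by (auto simp: hits_horizontal_def)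

lemma finite_collision_times: "finite (collision_times a b z)"
proof -
  obtain x y vx vy where z: "z = ((x, y), (vx, vy))"
    by (metis surj_pair)
  have hit: "t = (c - q) / r" if "q + t * r = c" "r \<noteq> 0" for t c q r :: real
    using that by (auto simp: eq_divide_eq)
  have "collision_times a b z \<subseteq>
    {(0 - x) / vx, (1/2 - x) / vx, (a - x) / vx, (0 - y) / vy, (1/2 - y) / vy}"
  proof
    fix t
    assume "t \<in> collision_times a b z"
    then have "hits_vertical a b (x + t * vx, y + t * vy) (vx, vy) \<or>
        hits_horizontal (x + t * vx, y + t * vy) (vx, vy)"
      by (simp add: z collision_times_def)
    then have "x + t * vx \<in> {0, 1/2, a} \<and> vx \<noteq> 0 \<or> y + t * vy \<in> {0, 1/2} \<and> vy \<noteq> 0"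
      using hits_verticalD hits_horizontalD by (metis fst_conv snd_conv)
    then consider "x + t * vx = 0" "vx \<noteq> 0" | "x + t * vx = 1/2" "vx \<noteq> 0"
      | "x + t * vx = a" "vx \<noteq> 0" | "y + t * vy = 0" "vy \<noteq> 0" | "y + t * vy = 1/2" "vy \<noteq> 0"
      by blast
    then have "t = (0 - x) / vx \<or> t = (1/2 - x) / vx \<or> t = (a - x) / vx
        \<or> t = (0 - y) / vy \<or> t = (1/2 - y) / vy"
      using hit by metis
    then show "t \<in> {(0 - x) / vx, (1/2 - x) / vx, (a - x) / vx, (0 - y) / vy, (1/2 - y) / vy}"
      by blast
  qed
  then show ?thesis
    by (rule finite_subset) simp
qed

lemma reflect_fixed_iff:
  "reflect a b z = z \<longleftrightarrow> \<not> hits_vertical a b (fst z) (snd z) \<and> \<not> hits_horizontal (fst z) (snd z)"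
proof -
  obtain p vx vy where z: "z = (p, (vx, vy))"
    by (metis surj_pair)
  have "hits_vertical a b p (vx, vy) \<Longrightarrow> vx \<noteq> 0" "hits_horizontal p (vx, vy) \<Longrightarrow> vy \<noteq> 0"
    using hits_verticalD[of a b p "(vx, vy)"] hits_horizontalD[of p "(vx, vy)"] by simp_all
  then show ?thesis
    by (auto simp: z reflect_def)
qed

lemma collision_times_nonempty:
  assumes "z \<in> phase_space" "reflect a b z = z"
  shows "collision_times a b z \<noteq> {}"
proof -
  obtain x y vx vy where z: "z = ((x, y), (vx, vy))"
    by (metis surj_pair)
  have nh: "\<not> hits_vertical a b (x, y) (vx, vy)" "\<not> hits_horizontal (x, y) (vx, vy)"
    using assms reflect_fixed_iff[of a b z] by (auto simp: z phase_space_def)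
  have xy: "0 \<le> x" "x \<le> 1/2" "0 \<le> y" "y \<le> 1/2"
    using assms(1) by (auto simp: z phase_space_def table_def)
  have "vx \<noteq> 0 \<or> vy \<noteq> 0"
    using assms(1) by (auto simp: z phase_space_def norm_Pair)
  then consider "vx < 0" | "vx > 0" | "vy < 0" | "vy > 0"
    by linarith
  then have "\<exists>t. t \<in> collision_times a b z"
  proof cases
    case 1
    moreover have "0 < x"
      using nh xy 1 by (auto simp: less_le hits_vertical_def)
    ultimately have "0 < (0 - x) / vx" "x + (0 - x) / vx * vx = 0"
      using xy by (simp_all add: divide_neg_pos divide_pos_neg zero_less_divide_iff)
    then have "(0 - x) / vx \<in> collision_times a b z"
      using 1 by (simp add: z collision_times_def hits_vertical_def)
    then show ?thesis ..
  next
    case 2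
    moreover have "x < 1/2"
      using nh xy 2 by (auto simp: less_le hits_vertical_def)
    ultimately have "0 < (1/2 - x) / vx" "x + (1/2 - x) / vx * vx = 1/2"
      using xy by (simp_all add: divide_neg_pos divide_pos_neg zero_less_divide_iff)
    then have "(1/2 - x) / vx \<in> collision_times a b z"
      using 2 by (simp add: z collision_times_def hits_vertical_def)
    then show ?thesis ..
  next
    case 3
    moreover have "0 < y"
      using nh xy 3 by (auto simp: less_le hits_horizontal_def)
    ultimately have "0 < (0 - y) / vy" "y + (0 - y) / vy * vy = 0"
      using xy by (simp_all add: divide_neg_pos divide_pos_neg zero_less_divide_iff)
    then have "(0 - y) / vy \<in> collision_times a b z"
      using 3 by (simp add: z collision_times_def hits_horizontal_def)
    then show ?thesis ..
  next
    case 4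
    moreover have "y < 1/2"
      using nh xy 4 by (auto simp: less_le hits_horizontal_def)
    ultimately have "0 < (1/2 - y) / vy" "y + (1/2 - y) / vy * vy = 1/2"
      using xy by (simp_all add: divide_neg_pos divide_pos_neg zero_less_divide_iff)
    then have "(1/2 - y) / vy \<in> collision_times a b z"
      using 4 by (simp add: z collision_times_def hits_horizontal_def)
    then show ?thesis ..
  qed
  then show ?thesis
    by auto
qed

lemma flight_time_in_collision_times:
  assumes "z \<in> phase_space" "reflect a b z = z"
  shows "flight_time a b z \<in> collision_times a b z"
proof -
  have "Min (collision_times a b z) \<in> collision_times a b z"
    using assms finite_collision_times collision_times_nonempty by (intro Min_in) auto
  then show ?thesis
    by (simp add: flight_time_eq_Inf cInf_eq_Min finite_collision_times
        collision_times_nonempty assms)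
qed

lemma flight_time_pos:
  "z \<in> phase_space \<Longrightarrow> reflect a b z = z \<Longrightarrow> 0 < flight_time a b z"
  using flight_time_in_collision_times[of z a b]
  by (auto simp: collision_times_def split: prod.splits)

lemma not_collision_before_flight_time:
  "t < flight_time a b z \<Longrightarrow> t \<notin> collision_times a b z"
  using cInf_lower[of t "collision_times a b z"] bdd_below_finite[OF finite_collision_times]
  by (auto simp: flight_time_eq_Inf)

lemma reflect_in_phase_space: "z \<in> phase_space \<Longrightarrow> reflect a b z \<in> phase_space"
  by (auto simp: phase_space_def reflect_def norm_Pair)

lemma reflect_reflect:
  "0 < a \<Longrightarrow> a < 1/2 \<Longrightarrow> reflect a b (reflect a b z) = reflect a b z"
  by (cases z) (auto simp: reflect_def hits_vertical_def hits_horizontal_def mirror_def)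

lemma flow_reflect:
  "0 < a \<Longrightarrow> a < 1/2 \<Longrightarrow> flow a b t (reflect a b z) = flow a b t z"
  by (simp add: flow_def reflect_reflect)

lemma flow_0:
  assumes "z \<in> phase_space" "0 < a" "a < 1/2"
  shows "flow a b 0 z = reflect a b z"
proof -
  let ?z = "reflect a b z"
  have "0 < collision_time a b ?z (Suc 0)"
    using flight_time_pos[of ?z a b] assms
    by (simp add: collision_time_def reflect_in_phase_space reflect_reflect)
  then have "(LEAST n. 0 < collision_time a b ?z (Suc n)) = 0"
    by (intro Least_equality) auto
  then show ?thesis
    by (simp add: flow_def Let_def collision_time_def free_flight_def split: prod.split)
qed

definition speeds :: "state \<Rightarrow> real \<times> real" where
  "speeds z = (\<bar>fst (snd z)\<bar>, \<bar>snd (snd z)\<bar>)"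

lemma speeds_reflect: "speeds (reflect a b z) = speeds z"
  by (simp add: speeds_def reflect_def split: prod.split)

lemma speeds_free_flight: "speeds (free_flight t z) = speeds z"
  by (simp add: speeds_def free_flight_def split: prod.split)

lemma speeds_flow: "speeds (flow a b t z) = speeds z"
proof -
  have "speeds ((collision_map a b ^^ n) z') = speeds z'" for n z'
    by (induction n) (simp_all add: collision_map_def speeds_reflect speeds_free_flight)
  then show ?thesis
    by (simp add: flow_def Let_def speeds_reflect speeds_free_flight)
qed

section \<open>Orbits in lifted coordinates\<close>

definition side_sign :: "bool \<Rightarrow> real" where
  "side_sign right = (if right then 1 else - 1)"

lemma side_sign_simps [simp]: "side_sign True = 1" "side_sign False = - 1"
  by (simp_all add: side_sign_def)

text \<open>
  The abscissa \<open>X\<close> is scaled so that the line of the mirror corresponds to the integers and the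
  outer wall of either half to the half-integers; it advances by \<open>2 * u\<close> per unit of time.
\<close>

definition lift_state :: "real \<Rightarrow> real \<Rightarrow> bool \<Rightarrow> real \<Rightarrow> real \<Rightarrow> state" where
  "lift_state u w right X Y =
     ((1/4 + side_sign right * zigzag X / 2, zigzag Y),
      (side_sign right * u * slope X, w * slope Y))"

lemma collision_times_iff_reflect:
  "0 < t \<Longrightarrow> t \<in> collision_times a b z \<longleftrightarrow> reflect a b (free_flight t z) \<noteq> free_flight t z"
  by (cases z) (simp add: reflect_fixed_iff collision_times_def free_flight_def)

lemma collision_times_free_flight:
  assumes "r > 0" "t > 0"
  shows "t \<in> collision_times a b (free_flight r z) \<longleftrightarrow> r + t \<in> collision_times a b z"
  using assms by (simp add: collision_times_def free_flight_def scaleR_add_left add.assoc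
      split: prod.split)

locale lifted_orbit =
  fixes b u w \<beta> :: real
  assumes b: "0 < b" "b < 1/2" and u: "0 < u" and w: "0 < w" and unit: "u\<^sup>2 + w\<^sup>2 = 1"
begin

definition height :: "real \<Rightarrow> real" where
  "height X = \<beta> + w / (2 * u) * X"

definition hit :: "int \<Rightarrow> bool" where
  "hit k \<longleftrightarrow> zigzag (height (of_int k)) \<le> b"

definition orbit :: "(int \<Rightarrow> bool) \<Rightarrow> real \<Rightarrow> state" where
  "orbit \<sigma> X = lift_state u w (\<sigma> \<lfloor>X\<rfloor>) X (height X)"

text \<open>\<open>\<sigma> k\<close> tells whether the particle is in the right half while \<open>k \<le> X < k + 1\<close>.\<close>

definition legal :: "(int \<Rightarrow> bool) \<Rightarrow> int \<Rightarrow> bool" where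
  "legal \<sigma> K \<longleftrightarrow> (\<forall>k>K. \<sigma> k \<longleftrightarrow> \<not> \<sigma> (k - 1) \<or> hit k)"

text \<open>Excludes the one non-reflected state of a lift: moving left while on the mirror.\<close>

definition outgoing :: "(int \<Rightarrow> bool) \<Rightarrow> real \<Rightarrow> bool" where
  "outgoing \<sigma> X \<longleftrightarrow> (X = of_int \<lfloor>X\<rfloor> \<longrightarrow> hit \<lfloor>X\<rfloor> \<longrightarrow> \<sigma> \<lfloor>X\<rfloor>)"

lemma height_add: "height (X + 2 * u * t) = height X + w * t"
  using u by (simp add: height_def field_simps)

lemma height_mono: "X \<le> X' \<Longrightarrow> height X \<le> height X'"
  using u w by (simp add: height_def divide_right_mono)

lemma reflect_orbit:
  assumes "outgoing \<sigma> X"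
  shows "reflect (1/4) b (orbit \<sigma> X) = orbit \<sigma> X"
proof -
  let ?z = "orbit \<sigma> X"
  have z: "fst (fst ?z) = 1/4 + side_sign (\<sigma> \<lfloor>X\<rfloor>) * zigzag X / 2" "snd (fst ?z) = zigzag (height X)"
    "fst (snd ?z) = side_sign (\<sigma> \<lfloor>X\<rfloor>) * u * slope X" "snd (snd ?z) = w * slope (height X)"
    by (simp_all add: orbit_def lift_state_def)
  have "\<not> hits_horizontal (fst ?z) (snd ?z)"
    using zigzag_0_imp_slope[of "height X"] zigzag_half_imp_slope[of "height X"] w
    by (auto simp: hits_horizontal_def z)
  moreover have "\<not> hits_vertical (1/4) b (fst ?z) (snd ?z)"
  proof
    assume "hits_vertical (1/4) b (fst ?z) (snd ?z)"
    then consider "fst (fst ?z) = 0" "fst (snd ?z) < 0" | "fst (fst ?z) = 1/2" "fst (snd ?z) > 0"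
      | "fst (fst ?z) = 1/4" "snd (fst ?z) \<le> b" "fst (snd ?z) < 0"
      by (auto simp: hits_vertical_def mirror_def)
    then show False
    proof cases
      case 1
      then have "zigzag X = 1/2" "\<not> \<sigma> \<lfloor>X\<rfloor>"
        using zigzag_bounds[of X] by (cases "\<sigma> \<lfloor>X\<rfloor>"; simp add: z)+
      then show False
        using 1(2) zigzag_half_imp_slope[of X] u by (simp add: z)
    next
      case 2
      then have "zigzag X = 1/2" "\<sigma> \<lfloor>X\<rfloor>"
        using zigzag_bounds[of X] by (cases "\<sigma> \<lfloor>X\<rfloor>"; simp add: z)+
      then show False
        using 2(2) zigzag_half_imp_slope[of X] u by (simp add: z)
    next
      case 3
      then have X: "zigzag X = 0"
        by (cases "\<sigma> \<lfloor>X\<rfloor>"; simp add: z)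
      then have "\<not> \<sigma> \<lfloor>X\<rfloor>"
        using 3(3) zigzag_0_imp_slope[of X] u by (cases "\<sigma> \<lfloor>X\<rfloor>"; simp add: z)
      moreover have "hit \<lfloor>X\<rfloor>"
        using 3(2) X by (simp add: hit_def z zigzag_0_iff)
      ultimately show False
        using assms X by (simp add: outgoing_def zigzag_0_iff)
    qed
  qed
  ultimately show ?thesis
    by (simp add: reflect_fixed_iff)
qed

lemma orbit_in_phase_space: "orbit \<sigma> X \<in> phase_space"
proof -
  have "(side_sign (\<sigma> \<lfloor>X\<rfloor>) * u * slope X)\<^sup>2 = u\<^sup>2" "(w * slope (height X))\<^sup>2 = w\<^sup>2"
    by (simp_all add: power_mult_distrib side_sign_def slope_def)
  moreover have "0 \<le> 1/4 + side_sign (\<sigma> \<lfloor>X\<rfloor>) * zigzag X / 2"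
      "1/4 + side_sign (\<sigma> \<lfloor>X\<rfloor>) * zigzag X / 2 \<le> 1/2"
    using zigzag_bounds[of X] by (cases "\<sigma> \<lfloor>X\<rfloor>"; simp)+
  ultimately show ?thesis
    using zigzag_bounds[of "height X"] unit
    by (simp add: phase_space_def table_def orbit_def lift_state_def norm_Pair)
qed

lemma height_segment:
  assumes t: "0 < t" and free: "\<And>r. 0 < r \<Longrightarrow> r < t \<Longrightarrow> r \<notin> collision_times a b (orbit \<sigma> X)"
  shows "zigzag (height (X + 2 * u * t)) = zigzag (height X) + t * (w * slope (height X))"
    and "w * slope (height (X + 2 * u * t)) =
      (if hits_horizontal (c, zigzag (height X) + t * (w * slope (height X))) (c', w * slope (height X))
       then - (w * slope (height X)) else w * slope (height X))"
proof -
  have free': "\<not> hits_horizontal (c, zigzag (height X) + r * (w * slope (height X)))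
      (c', w * slope (height X))" if "0 < r" "r < t" for r
    using free[OF that] that
    by (simp add: collision_times_def orbit_def lift_state_def hits_horizontal_def)
  show "zigzag (height (X + 2 * u * t)) = zigzag (height X) + t * (w * slope (height X))"
    using zigzag_segment(1)[OF w t, where Y = "height X" and x = "\<lambda>_. c" and c = c'] free' by (simp add: height_add)
  show "w * slope (height (X + 2 * u * t)) =
      (if hits_horizontal (c, zigzag (height X) + t * (w * slope (height X))) (c', w * slope (height X))
       then - (w * slope (height X)) else w * slope (height X))"
    using zigzag_segment(2)[OF w t, where Y = "height X" and x = "\<lambda>_. c" and c = c'] free' by (simp add: height_add)
qed

lemma orbit_segmentI:
  assumes t: "0 < t" and free: "\<And>r. 0 < r \<Longrightarrow> r < t \<Longrightarrow> r \<notin> collision_times (1/4) b (orbit \<sigma> X)"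
    and X': "X' = X + 2 * u * t"
    and pos: "1/4 + side_sign (\<sigma> \<lfloor>X'\<rfloor>) * zigzag X' / 2 =
      1/4 + side_sign (\<sigma> \<lfloor>X\<rfloor>) * zigzag X / 2 + t * (side_sign (\<sigma> \<lfloor>X\<rfloor>) * u * slope X)"
    and vel: "side_sign (\<sigma> \<lfloor>X'\<rfloor>) * u * slope X' =
      (if hits_vertical (1/4) b (1/4 + side_sign (\<sigma> \<lfloor>X'\<rfloor>) * zigzag X' / 2, zigzag (height X'))
          (side_sign (\<sigma> \<lfloor>X\<rfloor>) * u * slope X, w * slope (height X))
       then - (side_sign (\<sigma> \<lfloor>X\<rfloor>) * u * slope X) else side_sign (\<sigma> \<lfloor>X\<rfloor>) * u * slope X)"
  shows "reflect (1/4) b (free_flight t (orbit \<sigma> X)) = orbit \<sigma> X'"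
proof -
  define x vx vy where "x = 1/4 + side_sign (\<sigma> \<lfloor>X\<rfloor>) * zigzag X / 2"
    and "vx = side_sign (\<sigma> \<lfloor>X\<rfloor>) * u * slope X" and "vy = w * slope (height X)"
  define x' y' where "x' = x + t * vx" and "y' = zigzag (height X) + t * vy"
  have y': "zigzag (height X') = y'"
    "w * slope (height X') = (if hits_horizontal (x', y') (vx, vy) then - vy else vy)"
    using height_segment(1)[OF t free] height_segment(2)[OF t free, where c = x' and c' = vx]
    unfolding X' y'_def vy_def by simp_all
  have orb: "orbit \<sigma> X = ((x, zigzag (height X)), (vx, vy))"
    by (simp add: orbit_def lift_state_def x_def vx_def vy_def)
  have "orbit \<sigma> X' = ((x', y'), (if hits_vertical (1/4) b (x', y') (vx, vy) then - vx else vx,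
      if hits_horizontal (x', y') (vx, vy) then - vy else vy))"
    using pos vel y' by (simp only: orbit_def lift_state_def x'_def x_def vx_def vy_def)
  then show ?thesis
    by (simp add: orb reflect_def free_flight_def x'_def y'_def)
qed

lemma orbit_segment_away:
  assumes X: "of_int K \<le> X" "X < of_int K + 1/2"
    and t: "0 < t" and free: "\<And>r. 0 < r \<Longrightarrow> r < t \<Longrightarrow> r \<notin> collision_times (1/4) b (orbit \<sigma> X)"
  shows "reflect (1/4) b (free_flight t (orbit \<sigma> X)) = orbit \<sigma> (X + 2 * u * t)"
proof -
  define X' where "X' = X + 2 * u * t"
  define r where "r = (K + 1/2 - X) / (2 * u)"
  have r: "0 < r" "r * u * 2 = K + 1/2 - X" "r * u = (K + 1/2 - X) / 2"
    using X u by (simp_all add: r_def)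
  have K: "\<lfloor>X\<rfloor> = K"
    using X by linarith
  note up = zigzag_up[OF X]
  define s where "s = \<sigma> K"
  have "r \<in> collision_times (1/4) b (orbit \<sigma> X)"
    using r u by (cases s) (simp_all add: collision_times_def orbit_def lift_state_def K up
        hits_vertical_def s_def[symmetric] r(3) add_divide_distrib diff_divide_distrib)
  then have "\<not> r < t"
    using free r by blast
  then have "t * u * 2 \<le> r * u * 2"
    using u by simp
  then have le: "X' \<le> K + 1/2"
    using r(2) by (simp add: X'_def mult_ac)
  have gt: "X < X'"
    using u t by (simp add: X'_def)
  have K': "\<lfloor>X'\<rfloor> = K"
    using le gt X by linarith
  have X'_eq: "t * u = (X' - X) / 2"
    by (simp add: X'_def)
  show ?thesis
    unfolding X'_def[symmetric]
  proof (rule orbit_segmentI[OF t free X'_def])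
    have zz: "zigzag X' = X' - K"
      using zigzag_up[of K X'] zigzag_down[of K X'] le gt X by (cases "X' = K + 1/2") auto
    then show "1/4 + side_sign (\<sigma> \<lfloor>X'\<rfloor>) * zigzag X' / 2 =
      1/4 + side_sign (\<sigma> \<lfloor>X\<rfloor>) * zigzag X / 2 + t * (side_sign (\<sigma> \<lfloor>X\<rfloor>) * u * slope X)"
      using X'_eq by (cases s) (simp_all add: K K' up s_def[symmetric] field_simps)
    show "side_sign (\<sigma> \<lfloor>X'\<rfloor>) * u * slope X' =
      (if hits_vertical (1/4) b (1/4 + side_sign (\<sigma> \<lfloor>X'\<rfloor>) * zigzag X' / 2, zigzag (height X'))
          (side_sign (\<sigma> \<lfloor>X\<rfloor>) * u * slope X, w * slope (height X))
       then - (side_sign (\<sigma> \<lfloor>X\<rfloor>) * u * slope X) else side_sign (\<sigma> \<lfloor>X\<rfloor>) * u * slope X)"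
    proof (cases "X' = K + 1/2")
      case True
      then have "slope X' = - 1"
        using zigzag_down[of K X'] by simp
      then show ?thesis
        using u True zz by (cases s) (simp_all add: K K' up s_def[symmetric] hits_vertical_def)
    next
      case False
      then have "slope X' = 1"
        using zigzag_up[of K X'] le gt X by simp
      moreover have "0 < zigzag X'" "zigzag X' < 1/2"
        using zz False le gt X by linarith+
      ultimately show ?thesis
        using u by (cases s) (simp_all add: K K' up s_def[symmetric] hits_vertical_def mirror_def)
    qed
  qed
qed

lemma orbit_segment_towards:
  assumes X: "of_int K + 1/2 \<le> X" "X < of_int K + 1" and legal: "legal \<sigma> K"
    and t: "0 < t" "X + 2 * u * t \<le> K + 1"
    and free: "\<And>r. 0 < r \<Longrightarrow> r < t \<Longrightarrow> r \<notin> collision_times (1/4) b (orbit \<sigma> X)"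
  shows "reflect (1/4) b (free_flight t (orbit \<sigma> X)) = orbit \<sigma> (X + 2 * u * t)"
proof -
  define X' where "X' = X + 2 * u * t"
  have K: "\<lfloor>X\<rfloor> = K"
    using X by linarith
  note down = zigzag_down[OF X]
  define s where "s = \<sigma> K"
  have le: "X' \<le> K + 1"
    using t(2) by (simp add: X'_def)
  have gt: "X < X'"
    using u t by (simp add: X'_def)
  have X'_eq: "t * u = (X' - X) / 2"
    by (simp add: X'_def)
  show ?thesis
    unfolding X'_def[symmetric]
  proof (rule orbit_segmentI[OF t(1) free X'_def])
    show "1/4 + side_sign (\<sigma> \<lfloor>X'\<rfloor>) * zigzag X' / 2 =
      1/4 + side_sign (\<sigma> \<lfloor>X\<rfloor>) * zigzag X / 2 + t * (side_sign (\<sigma> \<lfloor>X\<rfloor>) * u * slope X)"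
    proof (cases "X' = K + 1")
      case True
      then have "zigzag X' = 0"
        using zigzag_up[of "K + 1" X'] by simp
      then show ?thesis
        using X'_eq True by (cases s) (simp_all add: K down s_def[symmetric] field_simps)
    next
      case False
      then have "\<lfloor>X'\<rfloor> = K" "zigzag X' = K + 1 - X'"
        using zigzag_down[of K X'] le gt X by linarith+
      then show ?thesis
        using X'_eq by (cases s) (simp_all add: K down s_def[symmetric] field_simps)
    qed
    show "side_sign (\<sigma> \<lfloor>X'\<rfloor>) * u * slope X' =
      (if hits_vertical (1/4) b (1/4 + side_sign (\<sigma> \<lfloor>X'\<rfloor>) * zigzag X' / 2, zigzag (height X'))
          (side_sign (\<sigma> \<lfloor>X\<rfloor>) * u * slope X, w * slope (height X))
       then - (side_sign (\<sigma> \<lfloor>X\<rfloor>) * u * slope X) else side_sign (\<sigma> \<lfloor>X\<rfloor>) * u * slope X)"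
    proof (cases "X' = K + 1")
      case True
      then have "zigzag X' = 0" "slope X' = 1" and K': "\<lfloor>X'\<rfloor> = K + 1"
        using zigzag_up[of "K + 1" X'] by simp_all
      moreover have "\<sigma> (K + 1) \<longleftrightarrow> \<not> s \<or> zigzag (height X') \<le> b"
        using legal True by (simp add: legal_def s_def hit_def)
      ultimately show ?thesis
        using u zigzag_bounds(1)[of "height X'"]
        by (cases s; cases "zigzag (height X') \<le> b")
           (simp_all add: K K' down s_def[symmetric] hits_vertical_def mirror_def)
    next
      case False
      then have "\<lfloor>X'\<rfloor> = K" "0 < zigzag X'" "zigzag X' < 1/2" "slope X' = - 1"
        using zigzag_down[of K X'] le gt X by linarith+
      then show ?thesis
        using u by (cases s) (simp_all add: K down s_def[symmetric] hits_vertical_def mirror_def)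
    qed
  qed
qed

lemma legal_mono: "legal \<sigma> K \<Longrightarrow> K \<le> K' \<Longrightarrow> legal \<sigma> K'"
  by (auto simp: legal_def)

lemma orbit_segment:
  assumes legal: "legal \<sigma> \<lfloor>X\<rfloor>" and t: "0 < t"
    and free: "\<And>r. 0 < r \<Longrightarrow> r < t \<Longrightarrow> r \<notin> collision_times (1/4) b (orbit \<sigma> X)"
  shows "reflect (1/4) b (free_flight t (orbit \<sigma> X)) = orbit \<sigma> (X + 2 * u * t)"
proof (cases X rule: zigzag_cases)
  case (up K)
  then show ?thesis
    using orbit_segment_away t free by blast
next
  case (down K)
  show ?thesis
  proof (cases "X + 2 * u * t \<le> K + 1")
    case True
    then show ?thesis
      using orbit_segment_towards down t free legal by blast
  next
    case False
    define r where "r = (K + 1 - X) / (2 * u)"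
    have r: "0 < r" "X + 2 * u * r = K + 1"
      using down(2) u by (simp_all add: r_def)
    have rt: "r < t"
    proof -
      have "2 * u * r < 2 * u * t"
        using False r(2) by linarith
      then show ?thesis
        using u by simp
    qed
    have "reflect (1/4) b (free_flight r (orbit \<sigma> X)) = orbit \<sigma> (X + 2 * u * r)"
      using orbit_segment_towards[OF down(1,2) _ r(1)] down(3) legal rt free r(2) by simp
    moreover have "r \<notin> collision_times (1/4) b (orbit \<sigma> X)"
      using r rt free by blast
    then have "reflect (1/4) b (free_flight r (orbit \<sigma> X)) = free_flight r (orbit \<sigma> X)"
      using r(1) by (simp add: collision_times_iff_reflect)
    ultimately have ff: "free_flight r (orbit \<sigma> X) = orbit \<sigma> (X + 2 * u * r)"
      by simp
    have free': "q \<notin> collision_times (1/4) b (orbit \<sigma> (X + 2 * u * r))"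
      if "0 < q" "q < t - r" for q
      using that r(1) free[of "r + q"] by (simp add: collision_times_free_flight flip: ff)
    have "reflect (1/4) b (free_flight (t - r) (orbit \<sigma> (X + 2 * u * r))) =
        orbit \<sigma> (X + 2 * u * r + 2 * u * (t - r))"
      using rt free' by (intro orbit_segment_away[of "K + 1"]) (simp_all add: r(2))
    moreover have "free_flight (t - r) (free_flight r z) = free_flight t z" for z
      by (simp add: free_flight_def scaleR_add_left[symmetric] split: prod.split)
    moreover have "X + 2 * u * r + 2 * u * (t - r) = X + 2 * u * t"
      by (simp add: algebra_simps)
    ultimately show ?thesis
      by (simp only: flip: ff)
  qed
qed

lemma outgoing_after:
  assumes "legal \<sigma> \<lfloor>X\<rfloor>" "X < X'"
  shows "outgoing \<sigma> X'"
  unfolding outgoing_def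
proof (intro impI)
  assume "X' = of_int \<lfloor>X'\<rfloor>" and hit: "hit \<lfloor>X'\<rfloor>"
  then have "\<lfloor>X\<rfloor> < \<lfloor>X'\<rfloor>"
    using assms(2) by linarith
  then show "\<sigma> \<lfloor>X'\<rfloor>"
    using assms(1) hit by (simp add: legal_def)
qed

text \<open>Increases at every collision, which shows that collisions do not accumulate.\<close>

definition turns :: "real \<Rightarrow> int" where
  "turns X = \<lfloor>2 * X\<rfloor> + \<lfloor>2 * height X\<rfloor>"

lemma turns_mono: "X \<le> X' \<Longrightarrow> turns X \<le> turns X'"
  using height_mono[of X X'] by (auto simp: turns_def intro!: add_mono floor_mono)

lemma height_strict_mono: "X < X' \<Longrightarrow> height X < height X'"
  using u w by (simp add: height_def divide_strict_right_mono)

lemma floor_less_Ints: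
  fixes x y :: real
  assumes "x < y" "y \<in> \<int>"
  shows "\<lfloor>x\<rfloor> < \<lfloor>y\<rfloor>"
  using assms by (auto elim!: Ints_cases simp: floor_less_iff)

lemma turns_strict:
  assumes "X < X'" "zigzag X' \<in> {0, 1/2} \<or> zigzag (height X') \<in> {0, 1/2}"
  shows "turns X < turns X'"
proof -
  have "2 * X' \<in> \<int> \<or> 2 * height X' \<in> \<int>"
    using assms(2) zigzag_turn_imp_Ints by blast
  moreover have "\<lfloor>2 * X\<rfloor> \<le> \<lfloor>2 * X'\<rfloor>" "\<lfloor>2 * height X\<rfloor> \<le> \<lfloor>2 * height X'\<rfloor>"
    using assms(1) height_strict_mono[OF assms(1)] by (simp_all add: floor_mono)
  ultimately show ?thesis
    using floor_less_Ints[of "2 * X" "2 * X'"] floor_less_Ints[of "2 * height X" "2 * height X'"]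
      assms(1) height_strict_mono[OF assms(1)] by (auto simp: turns_def)
qed

lemma orbit_free_flight:
  assumes "legal \<sigma> \<lfloor>X\<rfloor>" "0 \<le> t" "t < flight_time (1/4) b (orbit \<sigma> X)"
  shows "free_flight t (orbit \<sigma> X) = orbit \<sigma> (X + 2 * u * t)"
proof (cases "t = 0")
  case True
  then show ?thesis
    by (simp add: free_flight_def split: prod.split)
next
  case False
  have free: "r \<notin> collision_times (1/4) b (orbit \<sigma> X)" if "r \<le> t" for r
    using that assms(3) by (intro not_collision_before_flight_time) simp
  then show ?thesis
    using orbit_segment[OF assms(1), of t] False assms(2)
      collision_times_iff_reflect[of t "1/4" b "orbit \<sigma> X"] by auto
qed

lemma collision_orbit:
  fixes \<sigma> X
  defines "X' \<equiv> X + 2 * u * flight_time (1/4) b (orbit \<sigma> X)"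
  assumes legal: "legal \<sigma> \<lfloor>X\<rfloor>" and out: "outgoing \<sigma> X"
  shows "X < X'"
    and "collision_map (1/4) b (orbit \<sigma> X) = orbit \<sigma> X'"
    and "turns X < turns X'"
proof -
  let ?\<tau> = "flight_time (1/4) b (orbit \<sigma> X)"
  let ?z = "free_flight ?\<tau> (orbit \<sigma> X)"
  have coll: "?\<tau> \<in> collision_times (1/4) b (orbit \<sigma> X)"
    using orbit_in_phase_space reflect_orbit[OF out] by (rule flight_time_in_collision_times)
  have pos: "0 < ?\<tau>"
    using orbit_in_phase_space reflect_orbit[OF out] by (rule flight_time_pos)
  then show less: "X < X'"
    using u by (simp add: X'_def)
  have "reflect (1/4) b ?z = orbit \<sigma> X'"
    unfolding X'_def using legal pos
    by (rule orbit_segment) (rule not_collision_before_flight_time)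
  then show "collision_map (1/4) b (orbit \<sigma> X) = orbit \<sigma> X'"
    by (simp add: collision_map_def)
  have fst: "fst ?z = fst (orbit \<sigma> X')"
    unfolding \<open>reflect (1/4) b ?z = orbit \<sigma> X'\<close>[symmetric] by (simp add: reflect_def split: prod.split)
  have "reflect (1/4) b ?z \<noteq> ?z"
    using coll pos by (simp add: collision_times_iff_reflect)
  then have "hits_vertical (1/4) b (fst ?z) (snd ?z) \<or> hits_horizontal (fst ?z) (snd ?z)"
    by (simp add: reflect_fixed_iff)
  then have "fst (fst ?z) \<in> {0, 1/2, 1/4} \<or> snd (fst ?z) \<in> {0, 1/2}"
    using hits_verticalD hits_horizontalD by blast
  then have "zigzag X' \<in> {0, 1/2} \<or> zigzag (height X') \<in> {0, 1/2}"
    unfolding fst using zigzag_bounds[of X'] by (auto simp: orbit_def lift_state_def side_sign_def split: if_splits)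
  with less show "turns X < turns X'"
    by (rule turns_strict)
qed

lemma collision_time_orbit:
  assumes legal: "legal \<sigma> \<lfloor>X\<rfloor>" and out: "outgoing \<sigma> X"
  shows "(collision_map (1/4) b ^^ n) (orbit \<sigma> X)
      = orbit \<sigma> (X + 2 * u * collision_time (1/4) b (orbit \<sigma> X) n) \<and>
    outgoing \<sigma> (X + 2 * u * collision_time (1/4) b (orbit \<sigma> X) n) \<and>
    0 \<le> collision_time (1/4) b (orbit \<sigma> X) n \<and>
    turns X + int n \<le> turns (X + 2 * u * collision_time (1/4) b (orbit \<sigma> X) n)"
proof (induction n)
  case 0
  then show ?case
    using out by (simp add: collision_time_def)
next
  case (Suc n)
  define X1 where "X1 = X + 2 * u * collision_time (1/4) b (orbit \<sigma> X) n"
  define \<tau> where "\<tau> = flight_time (1/4) b (orbit \<sigma> X1)"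
  have le: "X \<le> X1" and out1: "outgoing \<sigma> X1"
    using Suc u by (simp_all add: X1_def)
  have legal1: "legal \<sigma> \<lfloor>X1\<rfloor>"
    using legal le by (rule legal_mono[OF _ floor_mono])
  have ct: "collision_time (1/4) b (orbit \<sigma> X) (Suc n) = collision_time (1/4) b (orbit \<sigma> X) n + \<tau>"
    using Suc by (simp add: collision_time_def X1_def \<tau>_def)
  have X2: "X + 2 * u * collision_time (1/4) b (orbit \<sigma> X) (Suc n) = X1 + 2 * u * \<tau>"
    by (simp add: ct X1_def algebra_simps)
  note step = collision_orbit[OF legal1 out1, folded \<tau>_def]
  have "0 < \<tau>"
    using step(1) u by (simp add: zero_less_mult_iff)
  then show ?case
    unfolding X2 using Suc step outgoing_after[OF legal1 step(1)]
    by (simp add: ct flip: X1_def)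
qed

theorem flow_orbit:
  assumes legal: "legal \<sigma> \<lfloor>X\<rfloor>" and out: "outgoing \<sigma> X" and t: "0 \<le> t"
  shows "flow (1/4) b t (orbit \<sigma> X) = orbit \<sigma> (X + 2 * u * t)"
proof -
  let ?ct = "collision_time (1/4) b (orbit \<sigma> X)"
  define n where "n = (LEAST n. t < ?ct (Suc n))"
  have "\<exists>n. t < ?ct (Suc n)"
  proof (rule ccontr)
    assume "\<nexists>n. t < ?ct (Suc n)"
    then have le: "?ct (Suc n) \<le> t" for n
      by (simp add: not_less)
    define n where "n = nat (turns (X + 2 * u * t) - turns X)"
    have "turns X + int (Suc n) \<le> turns (X + 2 * u * ?ct (Suc n))"
      using collision_time_orbit[OF legal out] by blast
    also have "\<dots> \<le> turns (X + 2 * u * t)"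
      using le u by (intro turns_mono) simp
    finally show False
      by (simp add: n_def split: if_splits)
  qed
  then have less: "t < ?ct (Suc n)"
    unfolding n_def by (rule LeastI_ex)
  have le: "?ct n \<le> t"
  proof (cases n)
    case 0
    then show ?thesis
      using t by (simp add: collision_time_def)
  next
    case (Suc m)
    then have "\<not> t < ?ct (Suc m)"
      unfolding n_def by (intro not_less_Least) simp
    then show ?thesis
      by (simp add: Suc)
  qed
  define X1 where "X1 = X + 2 * u * ?ct n"
  note IH = collision_time_orbit[OF legal out, of n, folded X1_def]
  have "legal \<sigma> \<lfloor>X1\<rfloor>"
    using IH u by (intro legal_mono[OF legal] floor_mono) (simp add: X1_def)
  moreover have "t - ?ct n < flight_time (1/4) b (orbit \<sigma> X1)"
    using less IH by (simp add: collision_time_def)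
  ultimately have "free_flight (t - ?ct n) (orbit \<sigma> X1) = orbit \<sigma> (X1 + 2 * u * (t - ?ct n))"
    using le by (intro orbit_free_flight) simp_all
  also have "X1 + 2 * u * (t - ?ct n) = X + 2 * u * t"
    by (simp add: X1_def algebra_simps)
  finally show ?thesis
    using IH by (simp add: flow_def Let_def reflect_orbit[OF out] n_def[symmetric])
qed

end

section \<open>Histories\<close>

primrec replay :: "(nat \<Rightarrow> bool) \<Rightarrow> bool \<Rightarrow> nat \<Rightarrow> bool" where
  "replay h s 0 = s"
| "replay h s (Suc n) = (\<not> replay h s n \<or> h (Suc n))"

context lifted_orbit
begin

lemma legal_replay:
  assumes "legal \<sigma> K"
  shows "\<sigma> (K + int n) = replay (\<lambda>n. hit (K + int n)) (\<sigma> K) n"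
proof (induction n)
  case (Suc n)
  have "\<sigma> (K + int (Suc n)) \<longleftrightarrow> \<not> \<sigma> (K + int (Suc n) - 1) \<or> hit (K + int (Suc n))"
    using assms unfolding legal_def by (metis less_add_same_cancel1 of_nat_0_less_iff zero_less_Suc)
  moreover have "K + int (Suc n) - 1 = K + int n"
    by simp
  ultimately show ?case
    using Suc by (simp only: replay.simps)
qed simp

lemma legal_exists: "\<exists>\<sigma>. legal \<sigma> K \<and> \<sigma> K = s"
proof -
  define \<sigma> where "\<sigma> k = replay (\<lambda>n. hit (K + int n)) s (nat (k - K))" for k
  have "\<sigma> k \<longleftrightarrow> \<not> \<sigma> (k - 1) \<or> hit k" if "k > K" for k
  proof -
    have "nat (k - K) = Suc (nat (k - 1 - K))" "K + int (Suc (nat (k - 1 - K))) = k"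
      using that by simp_all
    then show ?thesis
      by (simp only: \<sigma>_def replay.simps)
  qed
  then have "legal \<sigma> K" "\<sigma> K = s"
    by (simp_all add: legal_def \<sigma>_def)
  then show ?thesis
    by blast
qed

lemma outgoing_if_reflect_orbit:
  assumes "reflect (1/4) b (orbit \<sigma> X) = orbit \<sigma> X"
  shows "outgoing \<sigma> X"
  unfolding outgoing_def
proof (intro impI)
  assume X: "X = of_int \<lfloor>X\<rfloor>" and hit: "hit \<lfloor>X\<rfloor>"
  have "zigzag X = 0" "slope X = 1"
    using X zigzag_0_iff zigzag_0_imp_slope by blast+
  moreover have "zigzag (height X) \<le> b"
    using hit X by (simp add: hit_def)
  moreover have "\<not> hits_vertical (1/4) b (fst (orbit \<sigma> X)) (snd (orbit \<sigma> X))"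
    using assms by (simp add: reflect_fixed_iff)
  ultimately show "\<sigma> \<lfloor>X\<rfloor>"
    using u zigzag_bounds(1)[of "height X"]
    by (cases "\<sigma> \<lfloor>X\<rfloor>") (simp_all add: orbit_def lift_state_def hits_vertical_def mirror_def)
qed

end

lemma lift_state_inject:
  assumes "0 < u" "0 < w" "lift_state u w s X Y = lift_state u w s' X' Y'"
  shows "s = s'" "frac X = frac X'" "frac Y = frac Y'"
proof -
  have pos: "side_sign s * zigzag X = side_sign s' * zigzag X'"
    and vel: "side_sign s * slope X = side_sign s' * slope X'"
    and Y: "zigzag Y = zigzag Y'" "slope Y = slope Y'"
    using assms by (simp_all add: lift_state_def)
  have "zigzag X = zigzag X' \<and> (s = s' \<or> zigzag X = 0)"
    using pos zigzag_bounds(1)[of X] zigzag_bounds(1)[of X']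
    by (cases s; cases s') simp_all
  then have "s = s' \<and> zigzag X = zigzag X' \<and> slope X = slope X'"
    using vel zigzag_0_imp_slope[of X] zigzag_0_imp_slope[of X']
    by (cases s; cases s') auto
  then show "s = s'" "frac X = frac X'" "frac Y = frac Y'"
    using Y by (blast intro: frac_eqI_zigzag)+
qed

lemma slope_of_abs_le_half:
  assumes "\<bar>Y\<bar> \<le> 1/2"
  shows "slope Y = (if 0 \<le> Y \<and> Y < 1/2 then 1 else - 1)"
proof -
  consider "0 \<le> Y" "Y < 1/2" | "Y = 1/2" | "Y < 0" "- 1/2 \<le> Y"
    using assms by linarith
  then show ?thesis
    using zigzag_up(2)[of 0 Y] zigzag_down(2)[of 0 Y] zigzag_down(2)[of "-1" Y]
    by cases (simp_all del: eq_divide_eq_numeral1)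
qed

definition lift_x :: "state \<Rightarrow> real" where
  "lift_x z = 2 * sgn (fst (snd z)) * (fst (fst z) - 1/4)"

definition lift_y :: "state \<Rightarrow> real" where
  "lift_y z = sgn (snd (snd z)) * snd (fst z)"

definition on_right :: "state \<Rightarrow> bool" where
  "on_right z \<longleftrightarrow> fst (fst z) > 1/4 \<or> fst (fst z) = 1/4 \<and> fst (snd z) > 0"

lemma lift_state_lift:
  assumes "z \<in> phase_space" "reflect (1/4) b z = z" "fst (snd z) \<noteq> 0" "snd (snd z) \<noteq> 0"
  shows "lift_state \<bar>fst (snd z)\<bar> \<bar>snd (snd z)\<bar> (on_right z) (lift_x z) (lift_y z) = z"
proof -
  obtain x y vx vy where z: "z = ((x, y), (vx, vy))"
    by (metis surj_pair)
  have xy: "0 \<le> x" "x \<le> 1/2" "0 \<le> y" "y \<le> 1/2"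
    using assms(1) by (auto simp: z phase_space_def table_def)
  have v: "vx \<noteq> 0" "vy \<noteq> 0"
    using assms by (simp_all add: z)
  have nh: "\<not> hits_vertical (1/4) b (x, y) (vx, vy)" "\<not> hits_horizontal (x, y) (vx, vy)"
    using assms(2) by (simp_all add: reflect_fixed_iff z)
  have Y: "zigzag (lift_y z) = y" "\<bar>vy\<bar> * slope (lift_y z) = vy"
  proof -
    have "\<bar>lift_y z\<bar> = y"
      using xy v by (simp add: lift_y_def z abs_mult abs_sgn_eq)
    then show "zigzag (lift_y z) = y" "\<bar>vy\<bar> * slope (lift_y z) = vy"
      using zigzag_of_abs_le_half[of "lift_y z"] slope_of_abs_le_half[of "lift_y z"] xy nh(2) v
      by (auto simp: lift_y_def z sgn_real_def hits_horizontal_def split: if_splits)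
  qed
  have "\<bar>lift_x z\<bar> = 2 * \<bar>x - 1/4\<bar>"
    using v by (simp add: lift_x_def z abs_mult abs_sgn_eq)
  moreover have "\<bar>x - 1/4\<bar> \<le> 1/4"
    using xy by linarith
  ultimately have X: "zigzag (lift_x z) = 2 * \<bar>x - 1/4\<bar>"
    "slope (lift_x z) = (if 0 \<le> lift_x z \<and> lift_x z < 1/2 then 1 else - 1)"
    using zigzag_of_abs_le_half[of "lift_x z"] slope_of_abs_le_half[of "lift_x z"] by simp_all
  have "side_sign (on_right z) * \<bar>x - 1/4\<bar> = x - 1/4"
    by (simp add: on_right_def side_sign_def z)
  then have "1/4 + side_sign (on_right z) * zigzag (lift_x z) / 2 = x"
    by (simp add: X)
  moreover have "side_sign (on_right z) * \<bar>vx\<bar> *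
      (if 0 \<le> lift_x z \<and> lift_x z < 1/2 then 1 else - 1) = vx"
  proof -
    have nv: "x = 0 \<longrightarrow> vx > 0" "x = 1/2 \<longrightarrow> vx < 0"
      using nh(1) v by (auto simp: hits_vertical_def)
    consider "x < 1/4" | "x = 1/4" | "1/4 < x"
      by linarith
    then show ?thesis
    proof cases
      case 1
      then show ?thesis
        using nv v xy by (cases "vx > 0") (auto simp: lift_x_def on_right_def side_sign_def z)
    next
      case 2
      then show ?thesis
        using v by (cases "vx > 0") (auto simp: lift_x_def on_right_def side_sign_def z)
    next
      case 3
      then show ?thesis
        using nv v xy by (cases "vx > 0") (auto simp: lift_x_def on_right_def side_sign_def z)
    qed
  qed
  then have "side_sign (on_right z) * \<bar>vx\<bar> * slope (lift_x z) = vx"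
    by (simp only: X(2))
  ultimately show ?thesis
    using Y by (simp add: lift_state_def z)
qed

definition crosses_mirror :: "real \<Rightarrow> state \<Rightarrow> int \<Rightarrow> bool" where
  "crosses_mirror b z k \<longleftrightarrow>
     zigzag (lift_y z + \<bar>snd (snd z)\<bar> / (2 * \<bar>fst (snd z)\<bar>) * (of_int k - lift_x z)) \<le> b"

definition has_history :: "real \<Rightarrow> state \<Rightarrow> bool" where
  "has_history b z \<longleftrightarrow>
     (\<forall>N. \<exists>s. replay (\<lambda>n. crosses_mirror b z (\<lfloor>lift_x z\<rfloor> - int N + int n)) s N = on_right z)"

lemma lifted_orbit_of_state:
  assumes "0 < b" "b < 1/2" "z \<in> phase_space" "fst (snd z) \<noteq> 0" "snd (snd z) \<noteq> 0"
  shows "lifted_orbit b \<bar>fst (snd z)\<bar> \<bar>snd (snd z)\<bar>"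
proof -
  have "norm (snd z) = 1"
    using assms(3) by (auto simp: phase_space_def)
  then have "(fst (snd z))\<^sup>2 + (snd (snd z))\<^sup>2 = 1"
    by (simp add: norm_prod_def)
  then show ?thesis
    using assms by unfold_locales simp_all
qed

lemma lifted_orbit_anchor:
  fixes b z
  defines "u \<equiv> \<bar>fst (snd z)\<bar>" and "w \<equiv> \<bar>snd (snd z)\<bar>"
  defines "\<beta> \<equiv> lift_y z - w / (2 * u) * lift_x z"
  assumes b: "0 < b" "b < 1/2" and z: "z \<in> phase_space" "reflect (1/4) b z = z"
    and v: "fst (snd z) \<noteq> 0" "snd (snd z) \<noteq> 0"
  shows "lifted_orbit.hit b u w \<beta> = crosses_mirror b z"
    and "\<sigma> \<lfloor>lift_x z\<rfloor> = on_right z \<Longrightarrow> lifted_orbit.orbit u w \<beta> \<sigma> (lift_x z) = z"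
proof -
  interpret lifted_orbit b u w \<beta>
    unfolding u_def w_def using b z(1) v by (rule lifted_orbit_of_state)
  have "height (of_int k) = lift_y z + w / (2 * u) * (of_int k - lift_x z)" for k
    unfolding height_def unfolding \<beta>_def by (simp add: right_diff_distrib)
  then show "hit = crosses_mirror b z"
    by (simp only: hit_def crosses_mirror_def fun_eq_iff flip: u_def w_def) simp
  show "\<sigma> \<lfloor>lift_x z\<rfloor> = on_right z \<Longrightarrow> orbit \<sigma> (lift_x z) = z"
    using lift_state_lift[OF z v] unfolding orbit_def height_def
    by (simp add: \<beta>_def u_def w_def)
qed

lemma attractor_subset: "attractor (1/4) b \<subseteq> {z \<in> phase_space. reflect (1/4) b z = z}"
proof
  fix z
  assume "z \<in> attractor (1/4) b"
  then obtain y where "y \<in> phase_space" "z = flow (1/4) b 0 y"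
    by (force simp: attractor_def)
  then show "z \<in> {z \<in> phase_space. reflect (1/4) b z = z}"
    by (simp add: flow_0 reflect_in_phase_space reflect_reflect)
qed

lemma has_history_imp_attractor:
  assumes b: "0 < b" "b < 1/2" and z: "z \<in> phase_space" "reflect (1/4) b z = z"
    and v: "fst (snd z) \<noteq> 0" "snd (snd z) \<noteq> 0" and hist: "has_history b z"
  shows "z \<in> attractor (1/4) b"
  unfolding attractor_def
proof
  fix t :: real
  assume "t \<in> {0..}"
  then have t: "0 \<le> t"
    by simp
  define u w where "u = \<bar>fst (snd z)\<bar>" and "w = \<bar>snd (snd z)\<bar>"
  define \<beta> where "\<beta> = lift_y z - w / (2 * u) * lift_x z"
  interpret lifted_orbit b u w \<beta>
    unfolding u_def w_def using b z(1) v by (rule lifted_orbit_of_state)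
  note anchor = lifted_orbit_anchor[OF b z v, folded u_def w_def, folded \<beta>_def]
  define X where "X = lift_x z - 2 * u * t"
  have "X \<le> lift_x z"
    using t u by (simp add: X_def)
  define N where "N = nat (\<lfloor>lift_x z\<rfloor> - \<lfloor>X - 1\<rfloor>)"
  have "\<lfloor>X - 1\<rfloor> \<le> \<lfloor>lift_x z\<rfloor>"
    using \<open>X \<le> lift_x z\<close> by (intro floor_mono) simp
  then have N: "\<lfloor>lift_x z\<rfloor> - int N = \<lfloor>X - 1\<rfloor>" "\<lfloor>X - 1\<rfloor> + int N = \<lfloor>lift_x z\<rfloor>"
    by (simp_all add: N_def)
  obtain s where s: "replay (\<lambda>n. hit (\<lfloor>X - 1\<rfloor> + int n)) s N = on_right z"
    using hist unfolding has_history_def anchor(1)[symmetric] N(1)[symmetric] by blast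
  obtain \<sigma> where \<sigma>: "legal \<sigma> \<lfloor>X - 1\<rfloor>" "\<sigma> \<lfloor>X - 1\<rfloor> = s"
    using legal_exists by blast
  have "\<sigma> \<lfloor>lift_x z\<rfloor> = on_right z"
    using legal_replay[OF \<sigma>(1), of N] \<sigma>(2) s by (simp only: N(2))
  moreover have "flow (1/4) b t (orbit \<sigma> X) = orbit \<sigma> (X + 2 * u * t)"
    using legal_mono[OF \<sigma>(1)] outgoing_after[OF \<sigma>(1)] t by (intro flow_orbit) simp_all
  ultimately have "flow (1/4) b t (orbit \<sigma> X) = z"
    using anchor(2) by (simp add: X_def)
  then show "z \<in> flow (1/4) b t ` phase_space"
    using orbit_in_phase_space by force
qed

lemma attractor_imp_has_history:
  assumes b: "0 < b" "b < 1/2" and v: "fst (snd z) \<noteq> 0" "snd (snd z) \<noteq> 0"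
    and attr: "z \<in> attractor (1/4) b"
  shows "has_history b z"
  unfolding has_history_def
proof
  fix N
  have z: "z \<in> phase_space" "reflect (1/4) b z = z"
    using attractor_subset attr by blast+
  define u w where "u = \<bar>fst (snd z)\<bar>" and "w = \<bar>snd (snd z)\<bar>"
  define X K where "X = lift_x z" and "K = \<lfloor>X\<rfloor>"
  define t where "t = (X - of_int (K - int N)) / (2 * u)"
  have "of_int K \<le> X"
    by (simp add: K_def)
  then have t: "0 \<le> t" "2 * u * t = X - of_int (K - int N)"
    using v by (simp_all add: t_def u_def)
  obtain y' where y': "y' \<in> phase_space" "flow (1/4) b t y' = z"
    using attr t(1) by (force simp: attractor_def)
  define y where "y = reflect (1/4) b y'"
  have y: "y \<in> phase_space" "reflect (1/4) b y = y" "flow (1/4) b t y = z"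
    using y' by (simp_all add: y_def reflect_in_phase_space reflect_reflect flow_reflect)
  have "speeds y = speeds z"
    using speeds_flow y(3) by metis
  then have uw: "\<bar>fst (snd y)\<bar> = u" "\<bar>snd (snd y)\<bar> = w"
    by (simp_all add: speeds_def u_def w_def)
  then have v': "fst (snd y) \<noteq> 0" "snd (snd y) \<noteq> 0"
    using v by (auto simp: u_def w_def)
  define \<beta> where "\<beta> = lift_y y - w / (2 * u) * lift_x y"
  interpret lifted_orbit b u w \<beta>
    unfolding u_def w_def using b z(1) v by (rule lifted_orbit_of_state)
  define X' where "X' = lift_x y"
  obtain \<sigma> where \<sigma>: "legal \<sigma> \<lfloor>X'\<rfloor>" "\<sigma> \<lfloor>X'\<rfloor> = on_right y"
    using legal_exists by blast
  have "orbit \<sigma> X' = y"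
    using lifted_orbit_anchor(2)[OF b y(1,2) v', unfolded uw, folded \<beta>_def] \<sigma>(2)
    by (simp add: X'_def)
  then have "orbit \<sigma> (X' + 2 * u * t) = z"
    using flow_orbit[OF \<sigma>(1) outgoing_if_reflect_orbit t(1)] y by simp
  then have eq: "lift_state u w (\<sigma> \<lfloor>X' + 2 * u * t\<rfloor>) (X' + 2 * u * t) (height (X' + 2 * u * t))
      = lift_state u w (on_right z) X (lift_y z)"
    using lift_state_lift[OF z v, folded u_def w_def] by (simp add: orbit_def X_def)
  note inj = lift_state_inject[OF u w eq]
  define m where "m = \<lfloor>X' + 2 * u * t\<rfloor> - K"
  have m: "X' + 2 * u * t = X + of_int m"
    using inj(2) by (simp add: frac_def m_def K_def)
  then have X': "X' = of_int (K + m - int N)"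
    using t(2) by simp
  have fl: "\<lfloor>X'\<rfloor> = K + m - int N" "\<lfloor>X' + 2 * u * t\<rfloor> = K + m - int N + int N"
    by (simp only: X' floor_of_int) (simp add: m_def)
  have hit_eq: "hit (m + k) = crosses_mirror b z k" for k
  proof -
    have "height (of_int (m + k)) = height (X' + 2 * u * t) + w / (2 * u) * (of_int k - X)"
    proof -
      have "\<beta> + c * of_int (m + k) = \<beta> + c * (X + of_int m) + c * (of_int k - X)" for c
        by (simp add: algebra_simps)
      then show ?thesis
        unfolding height_def m .
    qed
    moreover have "frac (height (X' + 2 * u * t) + w / (2 * u) * (of_int k - X)) =
        frac (lift_y z + w / (2 * u) * (of_int k - X))"
      using inj(3) by (rule frac_add_cong)
    ultimately have "zigzag (height (of_int (m + k))) = zigzag (lift_y z + w / (2 * u) * (of_int k - X))"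
      by (metis zigzag_cong)
    then show ?thesis
      by (simp only: hit_def crosses_mirror_def flip: X_def u_def w_def)
  qed
  have "on_right z = replay (\<lambda>n. hit (K + m - int N + int n)) (\<sigma> (K + m - int N)) N"
    using legal_replay[OF \<sigma>(1), of N] inj(1) by (simp only: fl)
  also have "(\<lambda>n. hit (K + m - int N + int n)) = (\<lambda>n. crosses_mirror b z (\<lfloor>lift_x z\<rfloor> - int N + int n))"
    unfolding hit_eq[symmetric] K_def X_def by (simp add: algebra_simps)
  finally show "\<exists>s. replay (\<lambda>n. crosses_mirror b z (\<lfloor>lift_x z\<rfloor> - int N + int n)) s N = on_right z"
    by blast
qed

section \<open>Measure of the attractor\<close>

definition base_measure :: "state measure" where
  "base_measure = restrict_space lborel table \<Otimes>\<^sub>M circle_measure"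

lemma phase_measure_eq: "phase_measure = completion base_measure"
  by (simp add: phase_measure_def base_measure_def)

lemma space_base_measure: "space base_measure = phase_space"
  using space_phase_measure by (simp add: phase_measure_eq)

lemma space_circle_measure: "space circle_measure = sphere 0 1"
  by (simp add: circle_measure_def space_restrict_space)

lemma sets_circle_measure: "sets circle_measure = sets (restrict_space borel (sphere 0 1))"
  by (simp add: circle_measure_def)

lemma finite_circle_measure: "finite_measure circle_measure"
  by standard (simp add: space_circle_measure emeasure_circle_measure)

lemma borel_measurable_pos [measurable]: "fst \<in> borel_measurable base_measure"
proof -
  have "(\<lambda>p. p) \<in> borel_measurable (restrict_space lborel table)"
    by (intro measurable_restrict_space1) simp
  then show ?thesis
    unfolding base_measure_def by (rule measurable_compose[OF measurable_fst])
qed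

lemma borel_measurable_dir [measurable]: "snd \<in> borel_measurable base_measure"
proof -
  have "(\<lambda>v. v) \<in> borel_measurable circle_measure"
    by (subst measurable_cong_sets[OF sets_circle_measure refl])
       (intro measurable_restrict_space1, simp)
  then show ?thesis
    unfolding base_measure_def by (rule measurable_compose[OF measurable_snd])
qed

lemma borel_measurable_coordinates [measurable]:
  "(\<lambda>z. fst (fst z)) \<in> borel_measurable base_measure"
  "(\<lambda>z. snd (fst z)) \<in> borel_measurable base_measure"
  "(\<lambda>z. fst (snd z)) \<in> borel_measurable base_measure"
  "(\<lambda>z. snd (snd z)) \<in> borel_measurable base_measure"
proof -
  have "fst \<in> borel_measurable (borel :: (real \<times> real) measure)"
    "snd \<in> borel_measurable (borel :: (real \<times> real) measure)"
    by (intro borel_measurable_continuous_onI continuous_intros)+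
  then show "(\<lambda>z. fst (fst z)) \<in> borel_measurable base_measure"
    "(\<lambda>z. snd (fst z)) \<in> borel_measurable base_measure"
    "(\<lambda>z. fst (snd z)) \<in> borel_measurable base_measure"
    "(\<lambda>z. snd (snd z)) \<in> borel_measurable base_measure"
    using measurable_compose[OF borel_measurable_pos] measurable_compose[OF borel_measurable_dir]
    by blast+
qed

lemma borel_measurable_zigzag [measurable]: "zigzag \<in> borel_measurable borel"
  unfolding zigzag_def[abs_def] frac_def by measurable

lemma borel_measurable_lift [measurable]:
  "lift_x \<in> borel_measurable base_measure" "lift_y \<in> borel_measurable base_measure"
  unfolding lift_x_def[abs_def] lift_y_def[abs_def] by measurable

lemma pred_on_right [measurable]: "Measurable.pred base_measure on_right"
  unfolding on_right_def[abs_def] by measurable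

lemma pred_replay [measurable (raw)]:
  assumes "\<And>n. Measurable.pred M (\<lambda>z. h z n)"
  shows "Measurable.pred M (\<lambda>z. replay (h z) s n)"
  using assms by (induction n) simp_all

lemma pred_has_history [measurable]: "Measurable.pred base_measure (has_history b)"
proof -
  have cross [measurable]:
    "Measurable.pred base_measure (\<lambda>z. crosses_mirror b z (\<lfloor>lift_x z\<rfloor> - int N + int n))" for N n
    unfolding crosses_mirror_def of_int_add of_int_diff by measurable
  show ?thesis
    unfolding has_history_def[abs_def] by (intro pred_intros_countable pred_intros_logic pred_replay cross pred_on_right)
qed

lemma pred_reflect_fixed [measurable]: "Measurable.pred base_measure (\<lambda>z. reflect a b z = z)"
  unfolding reflect_fixed_iff hits_vertical_def hits_horizontal_def mirror_def mem_Times_iff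
    singleton_iff atLeastAtMost_iff by measurable

lemma measurable_polar:
  "(\<lambda>\<theta>. (cos \<theta>, sin \<theta>)) \<in>
     measurable (restrict_space lborel {0..<2 * pi}) (restrict_space borel (sphere (0 :: real \<times> real) 1))"
  by (intro measurable_restrict_space2 measurable_restrict_space1)
     (auto simp: norm_Pair intro!: borel_measurable_continuous_onI continuous_intros)

lemma null_sets_circle_measure_axes:
  "{v \<in> sphere 0 1. fst v = 0 \<or> snd v = 0} \<in> null_sets circle_measure"
proof -
  let ?A = "{v :: real \<times> real. v \<in> sphere 0 1 \<and> (fst v = 0 \<or> snd v = 0)}"
  let ?f = "\<lambda>\<theta>::real. (cos \<theta>, sin \<theta>)"
  note f = measurable_polar
  have "closed {v :: real \<times> real. fst v = 0 \<or> snd v = 0}"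
    by (intro closed_Collect_disj closed_Collect_eq continuous_intros)
  then have A: "?A \<in> sets (restrict_space borel (sphere 0 1))"
    by (auto simp: sets_restrict_space_iff Collect_conj_eq intro!: borel_closed)
  have "{\<theta>. cos \<theta> = 0 \<or> sin \<theta> = 0} \<subseteq>
      range (\<lambda>i::int. of_int i * pi + pi / 2) \<union> range (\<lambda>i::int. of_int i * pi :: real)"
    by (auto simp: cos_zero_iff_int2 sin_zero_iff_int2)
  then have "countable {\<theta>::real. cos \<theta> = 0 \<or> sin \<theta> = 0}"
    by (rule countable_subset) simp
  then have "{0..<2 * pi} \<inter> {\<theta>. cos \<theta> = 0 \<or> sin \<theta> = 0} \<in> null_sets lborel"
    by (intro countable_imp_null_set_lborel) auto
  moreover have "?f -` ?A \<inter> space (restrict_space lborel {0..<2 * pi}) =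
      {0..<2 * pi} \<inter> {\<theta>. cos \<theta> = 0 \<or> sin \<theta> = 0}"
    by (auto simp: space_restrict_space norm_Pair)
  ultimately have "emeasure circle_measure ?A = 0"
    unfolding circle_measure_def using A
    by (simp add: emeasure_distr[OF f] emeasure_restrict_space null_sets_def)
  then show ?thesis
    using A by (simp add: null_sets_def sets_circle_measure)
qed

lemma null_sets_base_measure_axes:
  "{z \<in> phase_space. fst (snd z) = 0 \<or> snd (snd z) = 0} \<in> null_sets base_measure"
proof -
  interpret circle: finite_measure circle_measure
    by (rule finite_circle_measure)
  let ?V = "{v :: real \<times> real. v \<in> sphere 0 1 \<and> (fst v = 0 \<or> snd v = 0)}"
  have T: "table \<in> sets (restrict_space lborel table)"
    using sets.top[of "restrict_space lborel table"] by (simp add: space_restrict_space)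
  have "{z \<in> phase_space. fst (snd z) = 0 \<or> snd (snd z) = 0} = table \<times> ?V"
    by (auto simp: phase_space_def)
  moreover have "emeasure base_measure (table \<times> ?V) = 0" "table \<times> ?V \<in> sets base_measure"
    unfolding base_measure_def using T null_sets_circle_measure_axes
    by (simp_all add: circle.emeasure_pair_measure_Times null_sets_def)
  ultimately show ?thesis
    by (simp add: null_sets_def)
qed

lemma attractor_in_sets:
  assumes b: "0 < b" "b < 1/2"
  shows "attractor (1/4) b \<in> sets phase_measure"
proof -
  define S where "S = {z \<in> phase_space. fst (snd z) \<noteq> 0 \<and> snd (snd z) \<noteq> 0 \<and>
      reflect (1/4) b z = z \<and> has_history b z}"
  have "S \<in> sets base_measure"
    unfolding S_def space_base_measure[symmetric] by measurable
  moreover have "attractor (1/4) b = S \<union>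
      attractor (1/4) b \<inter> {z \<in> phase_space. fst (snd z) = 0 \<or> snd (snd z) = 0}"
    using attractor_subset[of b] has_history_imp_attractor[OF b] attractor_imp_has_history[OF b]
    by (auto simp: S_def)
  ultimately show ?thesis
    unfolding phase_measure_eq using null_sets_base_measure_axes
    by (intro sets_completionI) auto
qed

lemma attractor_iff_near_mirror:
  assumes b: "0 < b" "b < 1/2" and z: "z \<in> phase_space"
    and x: "fst (fst z) \<noteq> 1/4" "\<bar>fst (fst z) - 1/4\<bar> < b / 2" and y: "0 < snd (fst z)" "snd (fst z) < b"
    and v: "0 < snd (snd z)" "snd (snd z) < sgn (fst (fst z) - 1/4) * fst (snd z)"
  shows "z \<in> attractor (1/4) b \<longleftrightarrow> 1/4 < fst (fst z)"
proof -
  obtain x y vx vy where z_eq: "z = ((x, y), (vx, vy))"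
    by (metis surj_pair)
  note facts = x y v
  have vx: "sgn vx = sgn (x - 1/4)" "vy < \<bar>vx\<bar>" "vx \<noteq> 0" "vy > 0"
    using v x by (auto simp: z_eq sgn_real_def split: if_splits)
  have X: "lift_x z = 2 * \<bar>x - 1/4\<bar>"
    by (simp add: lift_x_def z_eq vx(1) abs_sgn mult.commute)
  have Y: "lift_y z = y"
    using vx by (simp add: lift_y_def z_eq)
  have fl: "\<lfloor>lift_x z\<rfloor> = 0"
    unfolding X using b x by (intro floor_unique) (simp_all add: z_eq)
  define q where "q = vy / \<bar>vx\<bar> * \<bar>x - 1/4\<bar>"
  have q: "lift_y z + \<bar>snd (snd z)\<bar> / (2 * \<bar>fst (snd z)\<bar>) * (of_int 0 - lift_x z) = y - q"
    unfolding X Y using vx by (simp add: z_eq q_def)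
  have "q \<le> 1 * \<bar>x - 1/4\<bar>"
    unfolding q_def using vx by (intro mult_right_mono) (simp_all add: divide_le_eq)
  moreover have "0 \<le> q"
    using vx by (simp add: q_def)
  ultimately have "\<bar>y - q\<bar> \<le> b"
    using facts(2-4) b by (simp add: z_eq abs_le_iff)
  then have cross: "crosses_mirror b z 0"
    unfolding crosses_mirror_def q using zigzag_of_abs_le_half[of "y - q"] b by simp
  have hist: "has_history b z \<longleftrightarrow> 1/4 < x"
  proof
    assume "has_history b z"
    then obtain s where "replay (\<lambda>n. crosses_mirror b z (\<lfloor>lift_x z\<rfloor> - int 1 + int n)) s 1 = on_right z"
      unfolding has_history_def by blast
    then show "1/4 < x"
      using cross facts(1) fl by (simp add: on_right_def z_eq)
  next
    assume "1/4 < x"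
    then have "replay (\<lambda>n. crosses_mirror b z (\<lfloor>lift_x z\<rfloor> - int N + int n)) True N = on_right z" for N
      using cross fl by (cases N) (simp_all add: on_right_def z_eq)
    then show "has_history b z"
      unfolding has_history_def by blast
  qed
  have "reflect (1/4) b z = z"
    using x y b by (auto simp: z_eq reflect_fixed_iff hits_vertical_def hits_horizontal_def mirror_def)
  then show ?thesis
    using hist attractor_subset[of b] z vx
      has_history_imp_attractor[OF b, of z] attractor_imp_has_history[OF b, of z]
    by (auto simp: z_eq)
qed

definition near_mirror_box :: "real \<Rightarrow> real \<Rightarrow> real \<Rightarrow> state set" where
  "near_mirror_box l b e =
     ({l<..<l + b / 2} \<times> {0<..<b}) \<times> {v \<in> sphere 0 1. 0 < snd v \<and> snd v < e * fst v}"

lemma emeasure_circle_measure_sector_pos: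
  assumes "e = 1 \<or> e = - 1"
  shows "{v \<in> sphere 0 1. 0 < snd v \<and> snd v < e * fst v} \<in> sets circle_measure"
    and "0 < emeasure circle_measure {v \<in> sphere 0 1. 0 < snd v \<and> snd v < e * fst v}"
proof -
  let ?A = "{v :: real \<times> real. v \<in> sphere 0 1 \<and> 0 < snd v \<and> snd v < e * fst v}"
  let ?f = "\<lambda>\<theta>::real. (cos \<theta>, sin \<theta>)"
  note f = measurable_polar
  have "open {v :: real \<times> real. 0 < snd v \<and> snd v < e * fst v}"
    by (intro open_Collect_conj open_Collect_less continuous_intros)
  then have A: "?A \<in> sets (restrict_space borel (sphere 0 1))"
    by (auto simp: sets_restrict_space_iff Collect_conj_eq intro!: borel_open)
  then show "?A \<in> sets circle_measure"
    by (simp add: sets_circle_measure)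
  define c where "c = (if e = 1 then 0 else 3 * pi / 4)"
  have lt: "sin \<theta> < cos \<theta>" "0 < sin \<theta>" if "0 < \<theta>" "\<theta> < pi / 4" for \<theta> :: real
    using sin_monotone_2pi[of \<theta> "pi / 2 - \<theta>"] that
    by (auto simp: sin_diff intro: sin_gt_zero)
  have sub: "{c<..<c + pi / 4} \<subseteq> ?f -` ?A \<inter> space (restrict_space lborel {0..<2 * pi})"
  proof
    fix \<theta>
    assume \<theta>: "\<theta> \<in> {c<..<c + pi / 4}"
    show "\<theta> \<in> ?f -` ?A \<inter> space (restrict_space lborel {0..<2 * pi})"
    proof (cases "e = 1")
      case True
      then show ?thesis
        using \<theta> lt[of \<theta>] by (auto simp: c_def space_restrict_space norm_Pair)
    next
      case False
      then show ?thesis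
        using \<theta> lt[of "pi - \<theta>"] assms by (auto simp: c_def space_restrict_space norm_Pair)
    qed
  qed
  have "0 < emeasure lborel {c<..<c + pi / 4}"
    by simp
  also have "\<dots> \<le> emeasure lborel (?f -` ?A \<inter> space (restrict_space lborel {0..<2 * pi}))"
    using measurable_sets[OF f A] sub by (intro emeasure_mono) (auto simp: sets_restrict_space_iff)
  also have "\<dots> = emeasure circle_measure ?A"
    unfolding circle_measure_def using A
    by (simp add: emeasure_distr[OF f] emeasure_restrict_space space_restrict_space)
  finally show "0 < emeasure circle_measure ?A" .
qed

lemma near_mirror_box_measure:
  assumes b: "0 < b" "b < 1/2" and l: "0 \<le> l" "l \<le> 1/4" and e: "e = 1 \<or> e = - 1"
  shows "near_mirror_box l b e \<subseteq> phase_space"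
    and "near_mirror_box l b e \<in> sets base_measure"
    and "0 < emeasure base_measure (near_mirror_box l b e)"
proof -
  interpret circle: finite_measure circle_measure
    by (rule finite_circle_measure)
  let ?P = "{l<..<l + b / 2} \<times> {0<..<b}" and ?V = "{v \<in> sphere 0 1. 0 < snd v \<and> snd v < e * fst v}"
  have sub: "?P \<subseteq> table"
    using b l by (auto simp: table_def)
  then show "near_mirror_box l b e \<subseteq> phase_space"
    by (auto simp: near_mirror_box_def phase_space_def)
  have tab: "table \<in> sets lborel"
    unfolding table_def by (auto intro!: borel_closed closed_Times)
  have "?P \<in> sets lborel"
    by (auto intro!: borel_open open_Times)
  then have P: "?P \<in> sets (restrict_space lborel table)"
    using sub tab by (simp add: sets_restrict_space_iff)
  then show "near_mirror_box l b e \<in> sets base_measure"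
    unfolding near_mirror_box_def base_measure_def
    using emeasure_circle_measure_sector_pos(1)[OF e] by simp
  have "emeasure lborel ?P = ennreal (b / 2) * ennreal b"
    unfolding lborel_prod[symmetric] using b
    by (subst lborel.emeasure_pair_measure_Times) auto
  then have "0 < emeasure lborel ?P"
    using b by (simp add: ennreal_zero_less_mult_iff)
  then show "0 < emeasure base_measure (near_mirror_box l b e)"
    unfolding near_mirror_box_def base_measure_def
    using P emeasure_circle_measure_sector_pos[OF e] sub tab
    by (simp add: circle.emeasure_pair_measure_Times emeasure_restrict_space ennreal_zero_less_mult_iff)
qed

theorem corollary6:
  fixes a b :: real
  assumes "b \<in> {0<..<1/2}" and "a = 1/4"
  shows "attractor a b \<in> sets phase_measure \<and>
         0 < emeasure phase_measure (attractor a b) \<and>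
         emeasure phase_measure (attractor a b) < emeasure phase_measure phase_space"
proof -
  have b: "0 < b" "b < 1/2"
    using assms(1) by simp_all
  let ?A = "attractor (1/4) b"
  let ?R = "near_mirror_box (1/4) b 1" and ?L = "near_mirror_box (1/4 - b / 2) b (- 1)"
  note R = near_mirror_box_measure[OF b, of "1/4" 1]
  have "0 \<le> 1/4 - b / 2" "1/4 - b / 2 \<le> 1/4"
    using b by simp_all
  note L = near_mirror_box_measure[OF b this, of "- 1"]
  have em: "emeasure phase_measure S = emeasure base_measure S" "S \<in> sets phase_measure"
    if "S \<in> sets base_measure" for S
    using that by (simp_all add: phase_measure_eq)
  have A: "?A \<in> sets phase_measure"
    using b by (rule attractor_in_sets)
  have "?R \<subseteq> ?A"
  proof
    fix z
    assume z: "z \<in> ?R"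
    then have "z \<in> phase_space"
      using R(1) by auto
    then show "z \<in> ?A"
      using z b attractor_iff_near_mirror[OF b, of z]
      by (auto simp: near_mirror_box_def)
  qed
  then have "emeasure phase_measure ?R \<le> emeasure phase_measure ?A"
    using A by (rule emeasure_mono)
  then have pos: "0 < emeasure phase_measure ?A"
    using R em[of ?R] by simp
  have disjoint: "?A \<inter> ?L = {}"
  proof -
    have "z \<notin> ?A" if z: "z \<in> ?L" for z
    proof -
      have "z \<in> phase_space"
        using z L(1) by auto
      then show ?thesis
        using z b attractor_iff_near_mirror[OF b, of z] by (auto simp: near_mirror_box_def)
    qed
    then show ?thesis
      by blast
  qed
  have LS: "?L \<in> sets phase_measure" "?L \<subseteq> phase_space" "0 < emeasure phase_measure ?L"
    using L em[of ?L] by simp_all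
  have S: "phase_space \<in> sets phase_measure"
    using sets.top[of phase_measure] by (simp add: space_phase_measure)
  have "emeasure phase_measure ?A + emeasure phase_measure ?L = emeasure phase_measure (?A \<union> ?L)"
    using A LS disjoint by (intro plus_emeasure)
  also have "\<dots> \<le> emeasure phase_measure phase_space"
    using S LS attractor_subset by (intro emeasure_mono) auto
  finally have le: "emeasure phase_measure ?A + emeasure phase_measure ?L
      \<le> emeasure phase_measure phase_space" .
  have "emeasure phase_measure ?A \<noteq> \<infinity>"
    using le by (auto simp: emeasure_phase_space top_unique)
  then have "emeasure phase_measure ?A + 0 < emeasure phase_measure ?A + emeasure phase_measure ?L"
    unfolding ennreal_add_left_cancel_less using LS(3) by simp
  then have "emeasure phase_measure ?A < emeasure phase_measure ?A + emeasure phase_measure ?L"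
    by (simp only: add_0_right)
  then have "emeasure phase_measure ?A < emeasure phase_measure phase_space"
    using le by (rule less_le_trans)
  then show ?thesis
    unfolding assms(2) using A pos by blast
qed

end
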